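(* Let $\beta$ be a quadratic Pisot unit and let $m\in\mathbb{N}$ with $m>\beta-1$. Let $0=y_0<y_1<y_2<\cdots$ be the increasing enumeration of the spectrum $X^m(\beta)$. Then there exist real numbers $\Delta_1,\Delta_2>0$ such that, for all but finitely many $k\in\mathbb{N}$, the distance $y_{k+1}-y_k$ between consecutive points of $X^m(\beta)$ belongs to $\{\Delta_1,\Delta_2,\Delta_1+\Delta_2\}$.
   Context: A quadratic Pisot unit is a real number $\beta>1$ which is the larger root of $x^2-px-1$ with an integer $p\geq 1$, or of $x^2-px+1$ with an integer $p\geq 3$. For $m\in\mathbb{N}$ the spectrum is $$X^{m}(\beta) = \Big\{\sum_{j=0}^n a_j \beta^j : n\in\mathbb{N},\ a_j\in\{0,1,\dots,m\}\Big\},$$ where $\mathbb{N}=\{0,1,2,\dots\}$. For a Pisot number $\beta$ and $m\ge 1$ this is an infinite discrete closed subset of $[0,+\infty)$, so it can be enumerated increasingly. *)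

theory Defs
  imports Complex_Main
begin

definition larger_root :: "real \<Rightarrow> real \<Rightarrow> real \<Rightarrow> bool" where
  "larger_root b c \<beta> \<longleftrightarrow>
     \<beta>^2 + b * \<beta> + c = 0 \<and> (\<forall>x. x^2 + b * x + c = 0 \<longrightarrow> x \<le> \<beta>)"

definition quadratic_pisot_unit :: "real \<Rightarrow> bool" where
  "quadratic_pisot_unit \<beta> \<longleftrightarrow> \<beta> > 1 \<and>
     ((\<exists>p::int. p \<ge> 1 \<and> larger_root (- of_int p) (- 1) \<beta>) \<or>
      (\<exists>p::int. p \<ge> 3 \<and> larger_root (- of_int p) 1 \<beta>))"

definition spectrum :: "nat \<Rightarrow> real \<Rightarrow> real set" where
  "spectrum m \<beta> =
     {(\<Sum>j=0..n. real (a j) * \<beta> ^ j) | (n::nat) (a::nat \<Rightarrow> nat). \<forall>j\<le>n. a j \<in> {0..m}}"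

end

theory Submission
  imports Defs
begin

text \<open>
  Let \<open>g\<close> be the algebraic conjugate of \<open>\<beta>\<close>, so \<open>g = 1 / \<beta>\<close> or \<open>g = - 1 / \<beta>\<close>. The digit sums
  \<open>\<Sum>j\<le>n. a j * \<beta> ^ j\<close> lie in \<open>\<int>[\<beta>]\<close>, and their conjugates \<open>\<Sum>j\<le>n. a j * g ^ j\<close> stay in a bounded
  window between some \<open>l\<close> and \<open>r\<close>, because \<open>\<bar>g\<bar> < 1\<close>. So the spectrum is contained in the
  cut-and-project set of all elements of \<open>\<int>[\<beta>]\<close> with conjugate in this window, and such sets have
  three gap lengths \<open>\<Delta>\<^sub>1\<close>, \<open>\<Delta>\<^sub>2\<close>, \<open>\<Delta>\<^sub>1 + \<Delta>\<^sub>2\<close>: here \<open>\<Delta>\<^sub>1\<close> and \<open>\<Delta>\<^sub>2\<close> are the least positive elements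
  of \<open>\<int>[\<beta>]\<close> whose conjugate is positive, respectively negative, and smaller in modulus than the
  length of the window.

  The spectrum can differ from the cut-and-project set in infinitely many points, but for every
  \<open>e > 0\<close> all sufficiently large points whose conjugate keeps distance \<open>e\<close> from both ends of the
  window do belong to it. The lemma \<open>model_set_gaps\<close> shows that this is enough for the three gap
  lengths: a missing point whose conjugate is very close to one end of the window is a point at
  which a step \<open>\<Delta>\<^sub>1\<close> and a step \<open>\<Delta>\<^sub>2\<close> merge into a single step \<open>\<Delta>\<^sub>1 + \<Delta>\<^sub>2\<close>.

  To see that a large \<open>x\<close> with conjugate \<open>w\<close> well inside the window lies in the spectrum, digits
  \<open>a\<close> are split off one at a time, which replaces \<open>(x, w)\<close> by \<open>((x - a) / \<beta>, (w - a) / g)\<close>. As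
  \<open>1 / \<bar>g\<bar> = \<beta> > 1\<close>, choosing the extreme digit \<open>0\<close> or \<open>m\<close> drives \<open>w\<close> away from the ends of the
  window, and after a number of steps that depends only on \<open>e\<close> it has reached a core
  window: \<open>[0, \<beta>)\<close> for norm \<open>1\<close> and \<open>(-1, \<beta>)\<close> for norm \<open>-1\<close>. In the core, rounding \<open>w\<close> to an
  integer gives a digit expansion that ends: writing \<open>x = c + d * \<beta>\<close> with integers \<open>c\<close> and \<open>d \<ge> 0\<close>,
  the coefficient \<open>d\<close> stays nonnegative and decreases to \<open>0\<close>, when \<open>x\<close> is a digit itself
  (\<open>core_window_norm_1\<close>, \<open>core_window_norm_neg_1\<close>).
\<close>

section \<open>Gaps of cut-and-project sets with blurred window ends\<close>

definition eventually_three_gaps :: "real set \<Rightarrow> bool" where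
  "eventually_three_gaps S \<longleftrightarrow> (\<exists>D1 D2 C. 0 < D1 \<and> 0 < D2 \<and>
     (\<forall>x\<in>S. \<forall>x'\<in>S. C \<le> x \<and> x < x' \<and> (\<forall>t\<in>S. x < t \<longrightarrow> x' \<le> t) \<longrightarrow> x' - x \<in> {D1, D2, D1 + D2}))"

text \<open>
  The pairs \<open>(x, w)\<close> with \<open>conj x w\<close> are to be seen as a lattice in the plane, with \<open>w\<close> as the
  conjugate of \<open>x\<close>. Suppose the step \<open>z\<close> from \<open>x\<close> to the next point
  of \<open>S\<close> has positive conjugate. If it is not \<open>D1\<close>, then \<open>x + D1\<close> is missing, so its conjugate is
  beyond \<open>r - e\<close>. The remainder \<open>z - D1\<close> then has a conjugate that is negative, hence \<open>z - D1 \<ge> D2\<close>, or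
  below \<open>e\<close>, hence \<open>z - D1\<close> is large by the choice of \<open>e\<close>. So \<open>z \<ge> D1 + D2\<close>, which means that \<open>x + D2\<close>
  is missing as well; the two bounds on \<open>w\<close> obtained in this way put the conjugate of
  \<open>x + D1 + D2\<close> safely inside the window.
\<close>
lemma gap_with_positive_conjugate:
  fixes conj :: "real \<Rightarrow> real \<Rightarrow> bool"
  assumes diff: "\<And>x w x' w'. conj x w \<Longrightarrow> conj x' w' \<Longrightarrow> conj (x - x') (w - w')"
    and D1: "conj D1 s1" "0 < D1" "0 < s1" "s1 < r - l"
    and D2: "conj D2 (- s2)" "0 < D2" "0 < s2" "s2 < r - l"
    and min1: "\<And>x w. conj x w \<Longrightarrow> 0 < x \<Longrightarrow> 0 < w \<Longrightarrow> w < r - l \<Longrightarrow> D1 \<le> x"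
    and min2: "\<And>x w. conj x w \<Longrightarrow> 0 < x \<Longrightarrow> - (r - l) < w \<Longrightarrow> w < 0 \<Longrightarrow> D2 \<le> x"
    and e: "0 < e" "e \<le> s1" "e \<le> s2" "2 * e \<le> r - l - s1" "2 * e \<le> r - l - s2"
    and isolated: "\<And>x w. conj x w \<Longrightarrow> 0 < x \<Longrightarrow> x \<le> D1 + D2 \<Longrightarrow> e \<le> \<bar>w\<bar>"
    and fill: "\<And>x w. conj x w \<Longrightarrow> C \<le> x \<Longrightarrow> l + e \<le> w \<Longrightarrow> w \<le> r - e \<Longrightarrow> x \<in> S"
    and x: "conj x w" "C \<le> x" "l < w" "w < r"
    and z: "conj z v" "0 < z" "0 < v" "l < w + v" "w + v < r"
    and gap: "\<And>t. t \<in> S \<Longrightarrow> x < t \<Longrightarrow> x + z \<le> t"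
  shows "z = D1 \<or> z = D1 + D2"
proof (cases "z = D1")
  case False
  have add: "conj (a + b) (u + v)" if "conj a u" "conj b v" for a b u v
  proof -
    have "conj 0 0" using diff[OF that(1) that(1)] by simp
    from diff[OF that(1) diff[OF this that(2)]] show ?thesis by simp
  qed
  have "D1 \<le> z" using min1[OF z(1,2,3)] z x by simp
  with False have "D1 < z" by simp
  have "w + s1 > r - e"
  proof (rule ccontr)
    assume "\<not> ?thesis"
    then have "x + D1 \<in> S" using fill[OF add[OF x(1) D1(1)]] x D1 e by simp
    from gap[OF this] \<open>D1 < z\<close> D1 show False by simp
  qed
  have zD: "conj (z - D1) (v - s1)" using diff[OF z(1) D1(1)] .
  have "D1 + D2 \<le> z"
  proof (cases "v - s1 < 0")
    case True
    then show ?thesis using min2[OF zD] \<open>D1 < z\<close> D1 z by simp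
  next
    case F: False
    show ?thesis
    proof (rule ccontr)
      assume "\<not> ?thesis"
      then have "e \<le> \<bar>v - s1\<bar>" using isolated[OF zD] \<open>D1 < z\<close> D1 by simp
      then show False using F \<open>w + s1 > r - e\<close> z by simp
    qed
  qed
  have "w - s2 < l + e"
  proof (rule ccontr)
    assume "\<not> ?thesis"
    then have "x + D2 \<in> S" using fill[OF add[OF x(1) D2(1)]] x D2 e by simp
    from gap[OF this] \<open>D1 + D2 \<le> z\<close> D1 D2 show False by simp
  qed
  have "x + (D1 + D2) \<in> S"
    using fill[OF add[OF x(1) add[OF D1(1) D2(1)]]] \<open>w - s2 < l + e\<close> \<open>w + s1 > r - e\<close> x D1 D2 e
    by simp
  from gap[OF this] D1 D2 have "z \<le> D1 + D2" by simp
  with \<open>D1 + D2 \<le> z\<close> show ?thesis by simp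
qed simp

lemma least_with_conjugate_between:
  fixes conj :: "real \<Rightarrow> real \<Rightarrow> bool"
  assumes fin: "\<And>K. finite {(x, w). conj x w \<and> \<bar>x\<bar> \<le> K \<and> \<bar>w\<bar> \<le> K}"
    and ex: "\<exists>x w. conj x w \<and> 0 < x \<and> a < w \<and> w < b"
  obtains D s where "conj D s" "0 < D" "a < s" "s < b"
    "\<And>x w. conj x w \<Longrightarrow> 0 < x \<Longrightarrow> a < w \<Longrightarrow> w < b \<Longrightarrow> D \<le> x"
proof -
  obtain x0 w0 where x0: "conj x0 w0" "0 < x0" "a < w0" "w0 < b" using ex by blast
  define F where "F = {(x, w). conj x w \<and> 0 < x \<and> x \<le> x0 \<and> a < w \<and> w < b}"
  have "F \<subseteq> {(x, w). conj x w \<and> \<bar>x\<bar> \<le> max x0 (max \<bar>a\<bar> \<bar>b\<bar>) \<and> \<bar>w\<bar> \<le> max x0 (max \<bar>a\<bar> \<bar>b\<bar>)}"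
    by (auto simp: F_def)
  then have finF: "finite (fst ` F)" using fin finite_subset by blast
  have x0F: "x0 \<in> fst ` F" using x0 by (force simp: F_def)
  then have "Min (fst ` F) \<in> fst ` F" using finF by (intro Min_in) auto
  then obtain s where s: "(Min (fst ` F), s) \<in> F" by force
  have "Min (fst ` F) \<le> x" if "conj x w" "0 < x" "a < w" "w < b" for x w
  proof (cases "x \<le> x0")
    case True
    then have "x \<in> fst ` F" using that by (force simp: F_def)
    then show ?thesis using finF by simp
  next
    case False
    then show ?thesis using Min_le[OF finF x0F] by simp
  qed
  with s show ?thesis by (intro that[of "Min (fst ` F)" s]) (auto simp: F_def)
qed

text \<open>
  The least positive lattice points \<open>D1\<close> and \<open>D2\<close> exist by local finiteness. Steps with negative
  conjugate are reduced to those with positive conjugate by reflecting the second coordinate, which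
  exchanges \<open>D1\<close> and \<open>D2\<close>.
\<close>
lemma model_set_gaps:
  fixes conj :: "real \<Rightarrow> real \<Rightarrow> bool"
  assumes diff: "\<And>x w x' w'. conj x w \<Longrightarrow> conj x' w' \<Longrightarrow> conj (x - x') (w - w')"
    and ker: "\<And>x. conj x 0 \<Longrightarrow> x = 0"
    and fin: "\<And>K. finite {(x, w). conj x w \<and> \<bar>x\<bar> \<le> K \<and> \<bar>w\<bar> \<le> K}"
    and small_pos: "\<And>e. 0 < e \<Longrightarrow> \<exists>x w. conj x w \<and> 0 < x \<and> 0 < w \<and> w < e"
    and small_neg: "\<And>e. 0 < e \<Longrightarrow> \<exists>x w. conj x w \<and> 0 < x \<and> - e < w \<and> w < 0"
    and lr: "l < r"
    and inside: "\<And>x. x \<in> S \<Longrightarrow> 0 < x \<Longrightarrow> \<exists>w. conj x w \<and> l < w \<and> w < r"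
    and fill: "\<And>e. 0 < e \<Longrightarrow> \<exists>C. \<forall>x w. conj x w \<and> C \<le> x \<and> l + e \<le> w \<and> w \<le> r - e \<longrightarrow> x \<in> S"
  shows "eventually_three_gaps S"
proof -
  obtain D1 s1 where D1: "conj D1 s1" "0 < D1" "0 < s1" "s1 < r - l"
    and min1: "\<And>x w. conj x w \<Longrightarrow> 0 < x \<Longrightarrow> 0 < w \<Longrightarrow> w < r - l \<Longrightarrow> D1 \<le> x"
    by (rule least_with_conjugate_between[OF fin small_pos[of "r - l"]]) (use lr in \<open>simp, blast\<close>)
  obtain D2 s where D2: "conj D2 s" "0 < D2" "- (r - l) < s" "s < 0"
    and min2: "\<And>x w. conj x w \<Longrightarrow> 0 < x \<Longrightarrow> - (r - l) < w \<Longrightarrow> w < 0 \<Longrightarrow> D2 \<le> x"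
    by (rule least_with_conjugate_between[OF fin small_neg[of "r - l"]]) (use lr in \<open>simp, blast\<close>)
  define s2 where "s2 = - s"
  have D2': "conj D2 (- s2)" "0 < D2" "0 < s2" "s2 < r - l" using D2 by (simp_all add: s2_def)
  \<comment> \<open>The margin \<open>e\<close> is chosen not to exceed any \<open>\<bar>w\<bar> \<noteq> 0\<close> that occurs in a box containing all lattice points
    with \<open>0 < x \<le> D1 + D2\<close> and \<open>\<bar>w\<bar> \<le> 1\<close>, so that \<open>z - D1\<close> cannot be both short and nearly
    horizontal.\<close>
  define W where "W = (\<lambda>u. \<bar>snd u\<bar>) `
    {(x, w). conj x w \<and> \<bar>x\<bar> \<le> D1 + D2 + 1 \<and> \<bar>w\<bar> \<le> D1 + D2 + 1} - {0}"
  define e where "e = Min (W \<union> {1, s1, s2, (r - l - s1) / 2, (r - l - s2) / 2})"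
  have finW: "finite W" unfolding W_def using fin by blast
  have "0 < a" if "a \<in> W" for a using that by (auto simp: W_def)
  then have "0 < e" unfolding e_def using finW D1 D2' by (subst Min_gr_iff) auto
  have e_le: "e \<le> a" if "a \<in> W \<union> {1, s1, s2, (r - l - s1) / 2, (r - l - s2) / 2}" for a
    unfolding e_def using finW that by (intro Min_le) auto
  have e: "e \<le> s1" "e \<le> s2" "2 * e \<le> r - l - s1" "2 * e \<le> r - l - s2" "e \<le> 1"
    using e_le[of s1] e_le[of s2] e_le[of "(r - l - s1) / 2"] e_le[of "(r - l - s2) / 2"] e_le[of 1]
    by auto
  have isolated: "e \<le> \<bar>w\<bar>" if "conj x w" "0 < x" "x \<le> D1 + D2" for x w
  proof (cases "\<bar>w\<bar> \<le> 1")
    case True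
    have "w \<noteq> 0" using ker that by auto
    then have "\<bar>w\<bar> \<in> W" using that True D1 D2 by (force simp: W_def)
    then show ?thesis using e_le by blast
  qed (use e in simp)
  obtain C where C: "\<And>x w. conj x w \<Longrightarrow> C \<le> x \<Longrightarrow> l + e \<le> w \<Longrightarrow> w \<le> r - e \<Longrightarrow> x \<in> S"
    using fill[OF \<open>0 < e\<close>] by blast
  \<comment> \<open>Starting from \<open>1\<close> keeps the points positive, as \<open>inside\<close> requires.\<close>
  have "x' - x \<in> {D1, D2, D1 + D2}"
    if S: "x \<in> S" "x' \<in> S" "max C 1 \<le> x" "x < x'" and gap: "\<forall>t\<in>S. x < t \<longrightarrow> x' \<le> t" for x x'
  proof -
    obtain w where w: "conj x w" "l < w" "w < r" using inside[OF S(1)] S by auto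
    obtain w' where w': "conj x' w'" "l < w'" "w' < r" using inside[OF S(2)] S by auto
    have z: "conj (x' - x) (w' - w)" using diff[OF w'(1) w(1)] .
    then have "w' - w \<noteq> 0" using S(4) ker[of "x' - x"] by auto
    then consider "0 < w' - w" | "w' - w < 0" by linarith
    then show ?thesis
    proof cases
      case 1
      have "x' - x = D1 \<or> x' - x = D1 + D2"
        by (rule gap_with_positive_conjugate[OF diff D1 D2' min1 min2 \<open>0 < e\<close> e(1-4) isolated C
              w(1) _ w(2,3) z _ 1]) (use S gap w' in auto)
      then show ?thesis by blast
    next
      case 2
      have "x' - x = D2 \<or> x' - x = D2 + D1"
      proof (rule gap_with_positive_conjugate[of "\<lambda>x w. conj x (- w)" D2 s2 "- l" "- r" D1 s1 e C S x
            "- w" "x' - x" "w - w'"])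
        show "conj (a - b) (- (u - v))" if "conj a (- u)" "conj b (- v)" for a b u v
          using diff[OF that] by simp
        show "D2 \<le> a" if "conj a (- u)" "0 < a" "0 < u" "u < - l - - r" for a u
          using min2[OF that(1)] that by simp
        show "D1 \<le> a" if "conj a (- u)" "0 < a" "- (- l - - r) < u" "u < 0" for a u
          using min1[OF that(1)] that by simp
        show "e \<le> \<bar>u\<bar>" if "conj a (- u)" "0 < a" "a \<le> D2 + D1" for a u
          using isolated[OF that(1)] that by simp
        show "a \<in> S" if "conj a (- u)" "C \<le> a" "- r + e \<le> u" "u \<le> - l - e" for a u
          using C[OF that(1)] that by simp
      qed (use D1 D2' \<open>0 < e\<close> e w w' z S gap 2 in simp_all)
      then show ?thesis by auto
    qed
  qed
  then show ?thesis unfolding eventually_three_gaps_def using D1(2) D2(2)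
    by (intro exI[of _ D1] exI[of _ D2] exI[of _ "max C 1"]) simp
qed

section \<open>The spectrum as an inductively generated set\<close>

lemma digit_in_spectrum: "a \<le> m \<Longrightarrow> real a \<in> spectrum m \<beta>"
  unfolding spectrum_def by (rule CollectI, rule exI[of _ 0], rule exI[of _ "\<lambda>_. a"]) simp

lemma append_digit_in_spectrum:
  assumes "a \<le> m" "x \<in> spectrum m \<beta>"
  shows "real a + \<beta> * x \<in> spectrum m \<beta>"
proof -
  obtain n b where x: "x = (\<Sum>j=0..n. real (b j) * \<beta> ^ j)" and b: "\<forall>j\<le>n. b j \<in> {0..m}"
    using assms(2) by (auto simp: spectrum_def)
  have "real a + \<beta> * x = (\<Sum>j=0..Suc n. real (case_nat a b j) * \<beta> ^ j)"
    unfolding sum.atLeast0_atMost_Suc_shift by (simp add: x sum_distrib_left mult_ac)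
  moreover have "\<forall>j\<le>Suc n. case_nat a b j \<in> {0..m}"
    using assms(1) b by (auto split: nat.split)
  ultimately show ?thesis unfolding spectrum_def by blast
qed

lemma spectrum_induct [consumes 1, case_names digit append]:
  assumes "x \<in> spectrum m \<beta>"
    and digit: "\<And>a. a \<le> m \<Longrightarrow> P (real a)"
    and append: "\<And>a x. a \<le> m \<Longrightarrow> x \<in> spectrum m \<beta> \<Longrightarrow> P x \<Longrightarrow> P (real a + \<beta> * x)"
  shows "P x"
proof -
  have "P (\<Sum>j=0..n. real (b j) * \<beta> ^ j)" if "\<forall>j\<le>n. b j \<in> {0..m}" for n b
    using that
  proof (induction n arbitrary: b)
    case 0
    then show ?case using digit by simp
  next
    case (Suc n)
    have b: "\<forall>j\<le>n. b (Suc j) \<in> {0..m}" using Suc.prems by auto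
    have "(\<Sum>j=0..Suc n. real (b j) * \<beta> ^ j)
        = real (b 0) + \<beta> * (\<Sum>j=0..n. real (b (Suc j)) * \<beta> ^ j)"
      unfolding sum.atLeast0_atMost_Suc_shift by (simp add: sum_distrib_left mult_ac)
    moreover have "(\<Sum>j=0..n. real (b (Suc j)) * \<beta> ^ j) \<in> spectrum m \<beta>"
      unfolding spectrum_def using b by (intro CollectI exI[of _ n] exI[of _ "\<lambda>j. b (Suc j)"]) simp
    ultimately show ?case using append Suc.IH[OF b] Suc.prems by simp
  qed
  then show ?thesis using assms(1) by (auto simp: spectrum_def)
qed

section \<open>The ring generated by a quadratic unit, and conjugation\<close>

text \<open>
  Here \<open>\<beta>\<close> and \<open>g\<close> are the two roots of \<open>X\<^sup>2 - p X + s\<close>.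
\<close>
locale quadratic_unit =
  fixes \<beta> g :: real and p s :: int
  assumes beta_gt_1: "1 < \<beta>"
    and trace: "\<beta> + g = p"
    and norm: "\<beta> * g = s"
    and unit: "s = 1 \<or> s = - 1"
begin

text \<open>
  Conjugation is a relation between real numbers rather than a map. It is single-valued
  in both directions, as \<open>\<beta>\<close> and \<open>g\<close> are irrational; the gap argument needs this only in the form of
  \<open>conj_0_imp_0\<close> below.
\<close>
definition conj :: "real \<Rightarrow> real \<Rightarrow> bool" where
  "conj x w \<longleftrightarrow> (\<exists>(c::int) (d::int). x = c + d * \<beta> \<and> w = c + d * g)"

lemma g_eq: "g = s / \<beta>"
  using norm beta_gt_1 by (simp add: field_simps)

lemma abs_g: "\<bar>g\<bar> = 1 / \<beta>"
  using unit beta_gt_1 by (auto simp: g_eq)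

lemma abs_g_less_1: "\<bar>g\<bar> < 1"
  using abs_g beta_gt_1 by simp

lemma conj_coords: "conj (of_int c + of_int d * \<beta>) (of_int c + of_int d * g)"
  unfolding conj_def by blast

lemma conj_int: "conj (of_int a) (of_int a)"
  using conj_coords[of a 0] by simp

lemma conj_diff:
  assumes "conj x w" "conj x' w'"
  shows "conj (x - x') (w - w')"
proof -
  obtain c d c' d' :: int where "x = c + d * \<beta>" "w = c + d * g" "x' = c' + d' * \<beta>" "w' = c' + d' * g"
    using assms by (auto simp: conj_def)
  then show ?thesis using conj_coords[of "c - c'" "d - d'"] by (simp add: algebra_simps)
qed

lemma conj_add:
  assumes "conj x w" "conj x' w'"
  shows "conj (x + x') (w + w')"
  using conj_diff[OF assms(1) conj_diff[OF conj_int[of 0] assms(2)]] by simp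

lemma conj_mult_beta:
  assumes "conj x w"
  shows "conj (\<beta> * x) (g * w)"
proof -
  obtain c d :: int where x: "x = c + d * \<beta>" and w: "w = c + d * g"
    using assms by (auto simp: conj_def)
  have "\<beta> * x = of_int (- d * s) + of_int (c + d * p) * \<beta>"
    unfolding x of_int_mult of_int_add of_int_minus trace[symmetric] norm[symmetric]
    by (simp add: algebra_simps)
  moreover have "g * w = of_int (- d * s) + of_int (c + d * p) * g"
    unfolding w of_int_mult of_int_add of_int_minus trace[symmetric] norm[symmetric]
    by (simp add: algebra_simps)
  ultimately show ?thesis by (simp only: conj_coords)
qed

lemma conj_div_beta:
  assumes "conj x w"
  shows "conj (x / \<beta>) (s * \<beta> * w)"
proof -
  obtain c d :: int where x: "x = c + d * \<beta>" and w: "w = c + d * g"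
    using assms by (auto simp: conj_def)
  have ss: "of_int s * of_int s = (1::real)" using unit by auto
  have "x / \<beta> = d + c * (s * g)"
    using beta_gt_1 ss by (simp add: x g_eq field_simps)
  then have 1: "x / \<beta> = of_int (d + s * c * p) + of_int (- s * c) * \<beta>"
    by (simp add: algebra_simps flip: trace)
  have "s * \<beta> * w = s * c * \<beta> + s * (\<beta> * g) * d" by (simp add: w algebra_simps)
  also have "\<dots> = s * c * \<beta> + d" using ss by (simp add: norm)
  also have "\<dots> = of_int (d + s * c * p) + of_int (- s * c) * g"
    by (simp add: algebra_simps flip: trace)
  finally show ?thesis unfolding 1 by (simp only: conj_coords)
qed

lemma conj_power: "conj x w \<Longrightarrow> conj (\<beta> ^ n * x) (g ^ n * w)"
  by (induction n) (use conj_mult_beta in \<open>auto simp: mult.assoc\<close>)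

text \<open>
  The coefficients in \<open>x = c + d * \<beta>\<close> and \<open>w = c + d * g\<close> are bounded in terms of \<open>x\<close> and \<open>w\<close>, since
  \<open>d * (\<beta> - g) = x - w\<close>.
\<close>
lemma finite_conj_box: "finite {(x, w). conj x w \<and> \<bar>x\<bar> \<le> K \<and> \<bar>w\<bar> \<le> K}"
proof -
  define N where "N = \<lceil>2 * K / (\<beta> - g)\<rceil>"
  define M where "M = \<lceil>K + N * \<beta>\<rceil>"
  have pos: "0 < \<beta> - g" using abs_g_less_1 beta_gt_1 by simp
  have "{(x, w). conj x w \<and> \<bar>x\<bar> \<le> K \<and> \<bar>w\<bar> \<le> K}
      \<subseteq> (\<lambda>(c, d). (of_int c + of_int d * \<beta>, of_int c + of_int d * g)) ` ({-M..M} \<times> {-N..N})"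
  proof clarify
    fix x w assume "conj x w" and K: "\<bar>x\<bar> \<le> K" "\<bar>w\<bar> \<le> K"
    then obtain c d :: int where x: "x = c + d * \<beta>" and w: "w = c + d * g" by (auto simp: conj_def)
    have "\<bar>of_int d\<bar> * (\<beta> - g) = \<bar>x - w\<bar>"
      using pos by (simp add: x w abs_mult flip: right_diff_distrib)
    also have "\<dots> \<le> 2 * K" using K by simp
    finally have "\<bar>of_int d\<bar> \<le> 2 * K / (\<beta> - g)" using pos by (simp add: field_simps)
    then have d: "\<bar>d\<bar> \<le> N" unfolding N_def by linarith
    then have "\<bar>of_int d\<bar> \<le> real_of_int N" by linarith
    then have "\<bar>of_int d\<bar> * \<beta> \<le> N * \<beta>" using beta_gt_1 by (intro mult_right_mono) auto
    then have "\<bar>of_int d * \<beta>\<bar> \<le> N * \<beta>" using beta_gt_1 by (simp add: abs_mult)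
    then have "\<bar>of_int c\<bar> \<le> K + N * \<beta>" using K x by linarith
    then have "\<bar>c\<bar> \<le> M" unfolding M_def by linarith
    with d show "(x, w) \<in> (\<lambda>(c, d). (of_int c + of_int d * \<beta>, of_int c + of_int d * g)) `
        ({-M..M} \<times> {-N..N})"
      by (intro image_eqI[of _ _ "(c, d)"]) (auto simp: x w)
  qed
  then show ?thesis by (rule finite_subset) auto
qed

text \<open>
  Division by the unit \<open>\<beta>\<close> does not leave the ring. A nonzero \<open>x\<close> with conjugate \<open>0\<close> would thus give
  infinitely many points \<open>x / \<beta> ^ n\<close> with conjugate \<open>0\<close> in one bounded box.
\<close>
lemma conj_0_imp_0:
  assumes "conj x 0"
  shows "x = 0"
proof (rule ccontr)
  assume x: "x \<noteq> 0"
  have c: "conj (x / \<beta> ^ n) 0" for n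
  proof (induction n)
    case (Suc n)
    from conj_div_beta[OF Suc] show ?case by (simp add: mult.commute)
  qed (use assms in simp)
  have "1 \<le> \<beta> ^ n" for n using beta_gt_1 by (simp add: one_le_power)
  then have "\<bar>x\<bar> / \<beta> ^ n \<le> \<bar>x\<bar>" for n
    by (smt (verit) div_by_1 frac_le abs_ge_zero)
  then have "range (\<lambda>n. (x / \<beta> ^ n, 0)) \<subseteq> {(x', w). conj x' w \<and> \<bar>x'\<bar> \<le> \<bar>x\<bar> \<and> \<bar>w\<bar> \<le> \<bar>x\<bar>}"
    using c beta_gt_1 by (auto simp: abs_divide)
  then have "finite (range (\<lambda>n. (x / \<beta> ^ n, 0::real)))"
    using finite_conj_box finite_subset by blast
  moreover have "inj (\<lambda>n. (x / \<beta> ^ n, 0::real))"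
    using x beta_gt_1 by (intro injI) (auto simp: field_simps)
  ultimately show False using finite_imageD infinite_UNIV_nat by blast
qed

lemma ex_small_power:
  assumes "0 < (e::real)"
  obtains n where "K / \<beta> ^ n < e"
proof -
  obtain n where "max K 1 / e < \<beta> ^ n" using real_arch_pow beta_gt_1 by blast
  moreover have "0 < \<beta> ^ n" using beta_gt_1 by simp
  ultimately show ?thesis using assms that[of n] by (simp add: field_simps)
qed

text \<open>
  Even powers have positive conjugates whatever the sign of \<open>g\<close>. The factor \<open>2\<close> leaves room for
  multiplying by \<open>\<beta> - 1\<close>, whose conjugate lies strictly between \<open>-2\<close> and \<open>0\<close>; this is how negative
  conjugates are produced.
\<close>
lemma ex_small_even_conj:
  assumes "0 < (e::real)"
  obtains n where "0 < g ^ (2 * n)" "2 * g ^ (2 * n) < e"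
proof -
  obtain n where n: "2 / \<beta> ^ n < e" using ex_small_power assms by blast
  have "g ^ (2 * n) = (1 / \<beta>) ^ (2 * n)" by (metis abs_g even_mult_iff even_numeral power_even_abs)
  then have eq: "g ^ (2 * n) = 1 / \<beta> ^ (2 * n)" by (simp add: power_divide)
  have "\<beta> ^ n \<le> \<beta> ^ (2 * n)" using beta_gt_1 by (intro power_increasing) auto
  then have "2 / \<beta> ^ (2 * n) \<le> 2 / \<beta> ^ n" using beta_gt_1 by (intro divide_left_mono) auto
  with n eq beta_gt_1 show ?thesis by (intro that[of n]) auto
qed

lemma ex_small_positive_conj:
  assumes "0 < e"
  shows "\<exists>x w. conj x w \<and> 0 < x \<and> 0 < w \<and> w < e"
proof -
  obtain n where "0 < g ^ (2 * n)" "2 * g ^ (2 * n) < e" using ex_small_even_conj assms by blast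
  moreover have "conj (\<beta> ^ (2 * n)) (g ^ (2 * n))"
    using conj_power[OF conj_int[of 1], of "2 * n"] by simp
  ultimately show ?thesis using beta_gt_1
    by (intro exI[of _ "\<beta> ^ (2 * n)"] exI[of _ "g ^ (2 * n)"]) auto
qed

lemma ex_small_negative_conj:
  assumes "0 < e"
  shows "\<exists>x w. conj x w \<and> 0 < x \<and> - e < w \<and> w < 0"
proof -
  obtain n where n: "0 < g ^ (2 * n)" "2 * g ^ (2 * n) < e" using ex_small_even_conj assms by blast
  have "conj (\<beta> ^ (2 * n) * (\<beta> - 1)) (g ^ (2 * n) * (g - 1))"
    using conj_power[OF conj_coords[of "-1" 1], of "2 * n"] by simp
  moreover have "g ^ (2 * n) * (1 - g) \<le> g ^ (2 * n) * 2"
    using n abs_g_less_1 by (intro mult_left_mono) auto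
  then have "- e < g ^ (2 * n) * (g - 1)" using n by (simp add: algebra_simps)
  moreover have "g ^ (2 * n) * (g - 1) < 0" using n abs_g_less_1 by (intro mult_pos_neg) auto
  ultimately show ?thesis using beta_gt_1
    by (intro exI[of _ "\<beta> ^ (2 * n) * (\<beta> - 1)"] exI[of _ "g ^ (2 * n) * (g - 1)"]) auto
qed

lemma conj_remove_digit:
  assumes "conj x w"
  shows "conj ((x - of_int a) / \<beta>) (s * \<beta> * (w - of_int a))"
  using conj_div_beta[OF conj_diff[OF assms conj_int]] .

lemma in_spectrum_if_remainder:
  assumes "0 \<le> a" "a \<le> int m" "(x - of_int a) / \<beta> \<in> spectrum m \<beta>"
  shows "x \<in> spectrum m \<beta>"
  using append_digit_in_spectrum[OF _ assms(3), of "nat a"] assms(1,2) beta_gt_1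
  by (simp add: nat_le_iff)


section \<open>Core windows in which digit expansions end\<close>

lemma conj_coords_nonneg:
  assumes "conj x w" "w \<le> x"
  obtains c d :: int where "x = c + d * \<beta>" "w = c + d * g" "0 \<le> d"
proof -
  obtain c d :: int where x: "x = c + d * \<beta>" "w = c + d * g"
    using assms by (auto simp: conj_def)
  have "0 \<le> d * (\<beta> - g)" using assms(2) by (simp add: x algebra_simps)
  then have "0 \<le> d" using abs_g_less_1 beta_gt_1 by (auto simp: zero_le_mult_iff)
  with x show ?thesis by (rule that)
qed

text \<open>
  The digit is \<open>a = \<lfloor>w\<rfloor>\<close> for the conjugate \<open>w = c + d / \<beta>\<close>, so the new conjugate \<open>\<beta> * (w - a)\<close> is again
  in \<open>[0, \<beta>)\<close>. The new coefficient of \<open>\<beta>\<close> is \<open>a - c = \<lfloor>d / \<beta>\<rfloor>\<close>, which is nonnegative and less than \<open>d\<close>.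
\<close>
lemma core_window_norm_1:
  assumes s: "s = 1" and m: "\<beta> - 1 < real m"
  shows "0 \<le> d \<Longrightarrow> 0 \<le> of_int c + of_int d * g \<Longrightarrow> of_int c + of_int d * g < \<beta>
    \<Longrightarrow> of_int c + of_int d * \<beta> \<in> spectrum m \<beta>"
proof (induction "nat d" arbitrary: c d rule: less_induct)
  case less
  have g: "0 < g" "g < 1" "\<beta> * g = 1" "of_int p = \<beta> + g"
    using norm trace s beta_gt_1 abs_g_less_1 by (auto simp: g_eq)
  show ?case
  proof (cases "d = 0")
    case True
    then have "0 \<le> c" using less.prems by simp
    moreover from True have "c \<le> int m" using less.prems m by auto
    ultimately show ?thesis using digit_in_spectrum[of "nat c" m \<beta>] True by simp
  next
    case False
    with less.prems have d: "0 < d" by simp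
    define a where "a = \<lfloor>of_int c + of_int d * g\<rfloor>"
    \<comment> \<open>Coordinates of \<open>(c + d * \<beta> - a) / \<beta>\<close>, computed with \<open>1 / \<beta> = p - \<beta>\<close>.\<close>
    define c' d' where "c' = d + (c - a) * p" and "d' = a - c"
    have a: "of_int a \<le> of_int c + of_int d * g" "of_int c + of_int d * g < of_int a + 1"
      unfolding a_def by linarith+
    have a0: "0 \<le> a" using less.prems by (simp only: a_def zero_le_floor)
    have am: "a \<le> int m" using a less.prems m by linarith
    have "0 \<le> of_int d * g" using d g by simp
    then have "0 \<le> d'" unfolding d'_def a_def by linarith
    have "of_int d * g < of_int d" using d g by simp
    then have "d' < d" using a unfolding d'_def by linarith
    have w: "of_int c' + of_int d' * g = \<beta> * (of_int c + of_int d * g - of_int a)"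
    proof -
      have "of_int c' + of_int d' * g = of_int d + (of_int c - of_int a) * \<beta>"
        using g by (simp add: c'_def d'_def algebra_simps)
      also have "\<dots> = \<beta> * g * of_int d + (of_int c - of_int a) * \<beta>" using g by simp
      finally show ?thesis by (simp add: algebra_simps)
    qed
    have x: "(of_int c + of_int d * \<beta> - of_int a) / \<beta> = of_int c' + of_int d' * \<beta>"
    proof -
      have "of_int c' + of_int d' * \<beta> = of_int d + (of_int c - of_int a) * g"
        using g by (simp add: c'_def d'_def algebra_simps)
      then show ?thesis using beta_gt_1 s by (simp add: g_eq field_simps)
    qed
    have "of_int c' + of_int d' * \<beta> \<in> spectrum m \<beta>"
    proof (rule less.hyps)
      show "nat d' < nat d" using \<open>d' < d\<close> d by simp
      show "0 \<le> of_int c' + of_int d' * g" unfolding w using a beta_gt_1 by simp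
      have "\<beta> * (of_int c + of_int d * g - of_int a) < \<beta> * 1"
        using a beta_gt_1 by (intro mult_strict_left_mono) auto
      then show "of_int c' + of_int d' * g < \<beta>" unfolding w by simp
    qed fact
    then show ?thesis using in_spectrum_if_remainder a0 am x by metis
  qed
qed

text \<open>
  Now the conjugate \<open>w = c - d / \<beta>\<close> becomes \<open>\<beta> * (a - w)\<close>, so it is rounded up. For \<open>w \<le> p\<close> the digit
  \<open>a = \<lceil>w\<rceil>\<close> gives a new conjugate in \<open>[0, \<beta>)\<close> and a new coefficient \<open>c - a = \<lfloor>d / \<beta>\<rfloor> < d\<close>. For
  \<open>p < w < \<beta>\<close> the value \<open>\<lceil>w\<rceil> = p + 1\<close> may exceed \<open>m\<close>, and the digit \<open>p\<close> is used instead. Then \<open>d\<close> need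
  not shrink, but it does not grow, and the new conjugate lies in \<open>(-1, 0)\<close>, where the first case
  applies. The summand \<open>1\<close> in the induction measure accounts for this delay.
\<close>
lemma core_window_norm_neg_1:
  assumes s: "s = - 1" and m: "\<beta> - 1 < real m"
  shows "0 \<le> d \<Longrightarrow> - 1 < of_int c + of_int d * g \<Longrightarrow> of_int c + of_int d * g < \<beta>
    \<Longrightarrow> of_int c + of_int d * \<beta> \<in> spectrum m \<beta>"
proof (induction "nat (2 * d + (if of_int p < of_int c + of_int d * g then 1 else 0))"
    arbitrary: c d rule: less_induct)
  case less
  have g: "g < 0" "- 1 < g" "\<beta> * g = - 1" "of_int p = \<beta> + g"
    using norm trace s beta_gt_1 abs_g_less_1 by (auto simp: g_eq)
  have p: "0 < p" "p \<le> int m" using g m beta_gt_1 by linarith+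
  define w where "w = of_int c + of_int d * g"
  have w_less: "- 1 < w" "w < \<beta>" using less.prems by (simp_all add: w_def)
  show ?case
  proof (cases "d = 0")
    case True
    then have "0 \<le> c" using less.prems by auto
    moreover from True have "c \<le> int m" using less.prems m by auto
    ultimately show ?thesis using digit_in_spectrum[of "nat c" m \<beta>] True by simp
  next
    case False
    with less.prems have d: "0 < d" by simp
    have dg: "of_int d * g < 0" "- of_int d < of_int d * g"
      using d g mult_strict_left_mono[of "-1" g "of_int d"] by (simp_all add: mult_pos_neg)
    define a where "a = min p \<lceil>w\<rceil>"
    \<comment> \<open>Coordinates of \<open>(c + d * \<beta> - a) / \<beta>\<close>, computed with \<open>1 / \<beta> = \<beta> - p\<close>.\<close>
    define c' d' where "c' = d - (c - a) * p" and "d' = c - a"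
    have a0: "0 \<le> a" using w_less p unfolding a_def by linarith
    have am: "a \<le> int m" using p by (simp add: a_def)
    have w': "of_int c' + of_int d' * g = \<beta> * (of_int a - w)"
    proof -
      have "of_int c' + of_int d' * g = of_int d - (of_int c - of_int a) * \<beta>"
        using g by (simp add: c'_def d'_def algebra_simps)
      also have "\<dots> = - (\<beta> * g) * of_int d - (of_int c - of_int a) * \<beta>" using g by simp
      finally show ?thesis by (simp add: w_def algebra_simps)
    qed
    have x: "(of_int c + of_int d * \<beta> - of_int a) / \<beta> = of_int c' + of_int d' * \<beta>"
    proof -
      have "of_int c' + of_int d' * \<beta> = of_int d - (of_int c - of_int a) * g"
        using g by (simp add: c'_def d'_def algebra_simps)
      then show ?thesis using beta_gt_1 s by (simp add: g_eq field_simps)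
    qed
    have "of_int c' + of_int d' * \<beta> \<in> spectrum m \<beta>"
    proof (cases "of_int p < w")
      case True
      then have a: "a = p" by (simp add: a_def) linarith
      have d': "0 \<le> d'" using True dg unfolding d'_def a w_def by linarith
      have "of_int d' < - g * (of_int d + 1)"
        using w_less g unfolding d'_def a w_def by (simp add: algebra_simps)
      also have "\<dots> \<le> of_int d + 1"
        using g d mult_right_mono[of "- g" 1 "of_int d + 1"] by simp
      finally have "d' \<le> d" by linarith
      have neg: "\<beta> * (of_int a - w) < 0" using True a beta_gt_1 by (simp add: mult_pos_neg)
      have "\<beta> * g < \<beta> * (of_int a - w)"
        using w_less g beta_gt_1 unfolding a by (intro mult_strict_left_mono) auto
      then have "- 1 < \<beta> * (of_int a - w)" using g by simp
      moreover have "\<not> of_int p < \<beta> * (of_int a - w)" using neg p by linarith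
      moreover have "of_int a - w < 1" using True a by simp
      ultimately show ?thesis
        using neg beta_gt_1 d d' \<open>d' \<le> d\<close> True
        by (intro less.hyps) (simp_all add: w' flip: w_def)
    next
      case False
      then have a: "a = \<lceil>w\<rceil>" by (simp add: a_def ceiling_le_iff)
      have aw: "w \<le> of_int a" "of_int a < w + 1" unfolding a by linarith+
      have d': "0 \<le> d'" using dg unfolding d'_def a w_def by linarith
      have "d' < d" using aw dg unfolding d'_def w_def by linarith
      have "\<beta> * (of_int a - w) < \<beta> * 1"
        using aw beta_gt_1 by (intro mult_strict_left_mono) auto
      moreover have "0 \<le> \<beta> * (of_int a - w)" using aw beta_gt_1 by simp
      ultimately show ?thesis
        using d d' \<open>d' < d\<close> by (intro less.hyps) (simp_all add: w' flip: w_def)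
    qed
    then show ?thesis using in_spectrum_if_remainder a0 am x by metis
  qed
qed

section \<open>The spectrum fills its window up to the ends\<close>

text \<open>
  Conjugates of points of the spectrum lie in every set that contains the digits and is mapped into
  itself by the contractions \<open>w \<mapsto> a + g * w\<close>.
\<close>
lemma spectrum_conj_window:
  assumes "x \<in> spectrum m \<beta>"
    and "\<And>a. a \<le> m \<Longrightarrow> real a \<in> W"
    and "\<And>a w. a \<le> m \<Longrightarrow> w \<in> W \<Longrightarrow> real a + g * w \<in> W"
  shows "\<exists>w\<in>W. conj x w"
  using assms(1)
proof (induction rule: spectrum_induct)
  case (digit a)
  then show ?case using assms(2) conj_int[of "int a"] by auto
next
  case (append a x)
  then obtain w where w: "w \<in> W" "conj x w" by blast
  have "conj (real a + \<beta> * x) (real a + g * w)"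
    using conj_add[OF conj_int[of "int a"] conj_mult_beta[OF w(2)]] by simp
  then show ?case using assms(3)[OF append(1) w(1)] by blast
qed

text \<open>
  The window is \<open>[0, r)\<close>, where \<open>r\<close> is the value of the infinite digit string \<open>m m m \<dots>\<close> in base
  \<open>1 / \<beta>\<close>, that is, the fixed point of \<open>w \<mapsto> \<beta> * (w - m)\<close>. Splitting off the digit \<open>m\<close> multiplies the
  distance of the conjugate from \<open>r\<close> by \<open>\<beta>\<close>; the digit \<open>\<lfloor>w\<rfloor>\<close>, once it is available, leads into the
  core window.
\<close>
lemma spectrum_gaps_norm_1:
  assumes s: "s = 1" and m: "\<beta> - 1 < real m"
  shows "eventually_three_gaps (spectrum m \<beta>)"
proof -
  have g: "g = 1 / \<beta>" using s by (simp add: g_eq)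
  define r where "r = m * \<beta> / (\<beta> - 1)"
  have m0: "0 < real m" using m beta_gt_1 by simp
  have r0: "0 < r" using m0 beta_gt_1 by (simp add: r_def)
  have r_fix: "\<beta> * (r - m) = r" using beta_gt_1 by (simp add: r_def field_simps)
  have inside: "\<exists>w. conj x w \<and> 0 < w \<and> w < r" if x: "x \<in> spectrum m \<beta>" "0 < x" for x
  proof -
    have "\<exists>w\<in>{0..<r}. conj x w"
    proof (rule spectrum_conj_window[OF x(1)])
      show "real a \<in> {0..<r}" if "a \<le> m" for a
      proof -
        have "m < r" using m0 beta_gt_1 by (simp add: r_def field_simps)
        with that show ?thesis by simp
      qed
      show "real a + g * w \<in> {0..<r}" if "a \<le> m" "w \<in> {0..<r}" for a w
      proof -
        have "g * w < g * r" using that beta_gt_1 by (simp add: g divide_strict_right_mono)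
        also have "g * r = r - m" using r_fix beta_gt_1 by (simp add: g field_simps)
        finally show ?thesis using that beta_gt_1 by (simp add: g)
      qed
    qed
    then obtain w where "conj x w" "0 \<le> w" "w < r" by auto
    moreover from this have "w \<noteq> 0" using conj_0_imp_0 x by auto
    ultimately show ?thesis by (intro exI[of _ w]) simp
  qed
  \<comment> \<open>The bound \<open>\<beta> \<le> x\<close> forces \<open>w \<le> x\<close>, hence a nonnegative coefficient of \<open>\<beta>\<close>.\<close>
  have core: "x \<in> spectrum m \<beta>" if xw: "conj x w" "\<beta> \<le> x" "0 \<le> w" "w < \<beta>" for x w
  proof -
    obtain c d :: int where "x = c + d * \<beta>" "w = c + d * g" "0 \<le> d"
      by (rule conj_coords_nonneg[OF xw(1)]) (use xw in auto)
    then show ?thesis using core_window_norm_1[OF s m, of d c] xw by simp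
  qed
  have fill: "\<exists>C. \<forall>x w. conj x w \<and> C \<le> x \<and> 0 \<le> w \<and> w \<le> r - r / \<beta> ^ n \<longrightarrow> x \<in> spectrum m \<beta>" for n
  proof (induction n)
    case 0
    show ?case using core beta_gt_1 by (intro exI[of _ \<beta>]) auto
  next
    case (Suc n)
    then obtain C where C: "\<And>x w. conj x w \<Longrightarrow> C \<le> x \<Longrightarrow> 0 \<le> w \<Longrightarrow> w \<le> r - r / \<beta> ^ n
      \<Longrightarrow> x \<in> spectrum m \<beta>" by blast
    \<comment> \<open>After removing a digit and dividing by \<open>\<beta>\<close>, the point is still at least \<open>\<beta>\<close> and at least \<open>C\<close>.\<close>
    define C' where "C' = max (\<beta> * \<beta> + m) (\<beta> * C + m)"
    have "x \<in> spectrum m \<beta>"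
      if x: "conj x w" "C' \<le> x" "0 \<le> w" "w \<le> r - r / \<beta> ^ Suc n" for x w
    proof -
      define a where "a = min (int m) \<lfloor>w\<rfloor>"
      have a: "0 \<le> a" "a \<le> int m" "of_int a \<le> w" using x by (simp_all add: a_def min_def) linarith
      then have am: "real_of_int a \<le> m" by linarith
      define x' w' where "x' = (x - of_int a) / \<beta>" and "w' = \<beta> * (w - of_int a)"
      have c: "conj x' w'" using conj_remove_digit[OF x(1), of a] s by (simp add: x'_def w'_def)
      have "\<beta> * \<beta> \<le> x - of_int a" "\<beta> * C \<le> x - of_int a" using x am by (auto simp: C'_def)
      then have x': "\<beta> \<le> x'" "C \<le> x'" using beta_gt_1 by (auto simp: x'_def field_simps)
      have w': "0 \<le> w'" using a beta_gt_1 by (simp add: w'_def)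
      have "x' \<in> spectrum m \<beta>"
      proof (cases "w < of_int a + 1")
        case True
        then have "\<beta> * (w - of_int a) < \<beta> * 1" using beta_gt_1 by (intro mult_strict_left_mono) auto
        then show ?thesis using core[OF c] x' w' by (simp add: w'_def)
      next
        case False
        then have "a = int m" unfolding a_def by linarith
        then have "w' = r - \<beta> * (r - w)" using r_fix by (simp add: w'_def algebra_simps)
        moreover have "\<beta> * (r / \<beta> ^ Suc n) \<le> \<beta> * (r - w)"
          using x beta_gt_1 by (intro mult_left_mono) auto
        ultimately have "w' \<le> r - r / \<beta> ^ n" using beta_gt_1 by simp
        then show ?thesis using C[OF c] x' w' by simp
      qed
      then show ?thesis using in_spectrum_if_remainder a unfolding x'_def by blast
    qed
    then show ?case by blast
  qed
  show ?thesis
  proof (rule model_set_gaps[OF conj_diff conj_0_imp_0 finite_conj_box ex_small_positive_conj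
        ex_small_negative_conj r0 inside])
    fix e :: real assume "0 < e"
    then obtain n where n: "r / \<beta> ^ n < e" using ex_small_power by blast
    obtain C where C: "\<And>x w. conj x w \<and> C \<le> x \<and> 0 \<le> w \<and> w \<le> r - r / \<beta> ^ n \<Longrightarrow> x \<in> spectrum m \<beta>"
      using fill[of n] by blast
    have "x \<in> spectrum m \<beta>" if "conj x w \<and> C \<le> x \<and> 0 + e \<le> w \<and> w \<le> r - e" for x w
      by (rule C[of x w]) (use that n \<open>0 < e\<close> in auto)
    then show "\<exists>C. \<forall>x w. conj x w \<and> C \<le> x \<and> 0 + e \<le> w \<and> w \<le> r - e \<longrightarrow> x \<in> spectrum m \<beta>"
      by blast
  qed
qed

text \<open>
  The ends of the window are the values of \<open>0 m 0 m \<dots>\<close> and \<open>m 0 m 0 \<dots>\<close> in base \<open>- 1 / \<beta>\<close>. Removing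
  the digit \<open>0\<close> from a conjugate near \<open>l\<close>, or \<open>m\<close> from one near \<open>r\<close>, moves it to the other side of the
  window, where its distance from the end is \<open>\<beta>\<close> times the old distance.
\<close>
lemma spectrum_gaps_norm_neg_1:
  assumes s: "s = - 1" and m: "\<beta> - 1 < real m"
  shows "eventually_three_gaps (spectrum m \<beta>)"
proof -
  have g: "g = - 1 / \<beta>" using s by (simp add: g_eq)
  have "- 1 < g" "g < 0" using abs_g_less_1 g beta_gt_1 by simp_all
  then have p: "0 < real_of_int p" "real_of_int p < \<beta>" using trace beta_gt_1 by linarith+
  have p_beta: "\<beta> * \<beta> = p * \<beta> + 1" using norm s by (simp add: algebra_simps flip: trace)
  define l r where "l = - m / p" and "r = m * \<beta> / p"
  have m0: "0 < real m" using m beta_gt_1 by simp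
  have lr: "l < 0" "m < r" using m0 p by (simp_all add: l_def r_def field_simps)
  have r_l: "r = - \<beta> * l" by (simp add: l_def r_def)
  have l_r: "l = \<beta> * (m - r)"
  proof -
    have "\<beta> * (m - r) = m * (p * \<beta> - \<beta> * \<beta>) / p" using p(1) by (simp add: r_def field_simps)
    then show ?thesis by (simp add: p_beta l_def)
  qed
  have inside: "\<exists>w. conj x w \<and> l < w \<and> w < r" if x: "x \<in> spectrum m \<beta>" for x
  proof -
    have "\<exists>w\<in>{l<..<r}. conj x w"
    proof (rule spectrum_conj_window[OF x])
      show "real a \<in> {l<..<r}" if "a \<le> m" for a using that lr by simp
      show "real a + g * w \<in> {l<..<r}" if "a \<le> m" "w \<in> {l<..<r}" for a w
      proof -
        have "w / \<beta> < r / \<beta>" "l / \<beta> < w / \<beta>"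
          using that beta_gt_1 by (simp_all add: divide_strict_right_mono)
        moreover have "r / \<beta> = - l" "l / \<beta> = m - r"
          using beta_gt_1 by (simp add: r_l, subst l_r, simp)
        ultimately show ?thesis using that by (simp add: g)
      qed
    qed
    then show ?thesis by auto
  qed
  have core: "x \<in> spectrum m \<beta>" if xw: "conj x w" "\<beta> \<le> x" "- 1 < w" "w < \<beta>" for x w
  proof -
    obtain c d :: int where "x = c + d * \<beta>" "w = c + d * g" "0 \<le> d"
      by (rule conj_coords_nonneg[OF xw(1)]) (use xw in auto)
    then show ?thesis using core_window_norm_neg_1[OF s m, of d c] xw by simp
  qed
  \<comment> \<open>The margin is required only at the side on which \<open>w\<close> lies outside the core: a step from one end
    lands beyond the core at the other end, or in the core, so the other margin is never lost.
    For \<open>n = 0\<close> the margin is the whole length of the window and only the core remains.\<close>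
  have fill: "\<exists>C. \<forall>x w. conj x w \<and> C \<le> x \<and> (- 1 < w \<or> l + (r - l) / \<beta> ^ n \<le> w)
      \<and> (w < \<beta> \<or> w \<le> r - (r - l) / \<beta> ^ n) \<longrightarrow> x \<in> spectrum m \<beta>" for n
  proof (induction n)
    case 0
    have "- 1 < w \<and> w < \<beta>"
      if "- 1 < w \<or> l + (r - l) / \<beta> ^ 0 \<le> w" "w < \<beta> \<or> w \<le> r - (r - l) / \<beta> ^ 0" for w
      using that lr m0 beta_gt_1 by auto
    then show ?case using core by (intro exI[of _ \<beta>]) blast
  next
    case (Suc n)
    then obtain C where C: "\<And>x w. conj x w \<Longrightarrow> C \<le> x \<Longrightarrow> - 1 < w \<or> l + (r - l) / \<beta> ^ n \<le> w
      \<Longrightarrow> w < \<beta> \<or> w \<le> r - (r - l) / \<beta> ^ n \<Longrightarrow> x \<in> spectrum m \<beta>" by blast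
    define C' where "C' = max (max \<beta> (\<beta> * \<beta> + m)) (\<beta> * C + m)"
    have "x \<in> spectrum m \<beta>"
      if x: "conj x w" "C' \<le> x" "- 1 < w \<or> l + (r - l) / \<beta> ^ Suc n \<le> w"
        "w < \<beta> \<or> w \<le> r - (r - l) / \<beta> ^ Suc n" for x w
    proof (cases "- 1 < w \<and> w < \<beta>")
      case True
      then show ?thesis using core[OF x(1)] x(2) by (simp add: C'_def)
    next
      case F: False
      define a where "a = max 0 (min (int m) \<lceil>w\<rceil>)"
      have a: "0 \<le> a" "a \<le> int m" by (simp_all add: a_def)
      then have am: "real_of_int a \<le> m" by linarith
      define x' w' where "x' = (x - of_int a) / \<beta>" and "w' = \<beta> * (of_int a - w)"
      have c: "conj x' w'"
        using conj_remove_digit[OF x(1), of a] s by (simp add: x'_def w'_def algebra_simps)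
      have "\<beta> * \<beta> \<le> x - of_int a" "\<beta> * C \<le> x - of_int a" using x am by (auto simp: C'_def)
      then have x': "\<beta> \<le> x'" "C \<le> x'" using beta_gt_1 by (auto simp: x'_def field_simps)
      consider "w \<le> - 1" | "\<beta> \<le> w" "w \<le> m" | "\<beta> \<le> w" "m < w" using F by linarith
      then have "x' \<in> spectrum m \<beta>"
      proof cases
        case 1
        then have "a = 0" unfolding a_def by linarith
        then have w': "w' = r - \<beta> * (w - l)" by (simp add: w'_def r_l algebra_simps)
        have "\<beta> * ((r - l) / \<beta> ^ Suc n) \<le> \<beta> * (w - l)"
          using x 1 beta_gt_1 by (intro mult_left_mono) auto
        then have "w' \<le> r - (r - l) / \<beta> ^ n" using beta_gt_1 by (simp add: w')
        moreover have "- 1 < w'"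
          using \<open>a = 0\<close> 1 beta_gt_1 mult_pos_neg[of \<beta> w] by (simp add: w'_def)
        ultimately show ?thesis using C[OF c] x' by simp
      next
        case 2
        then have "a = \<lceil>w\<rceil>" using beta_gt_1 unfolding a_def by linarith
        then have aw: "w \<le> of_int a" "of_int a < w + 1" by linarith+
        then have "\<beta> * (of_int a - w) < \<beta> * 1" using beta_gt_1 by (intro mult_strict_left_mono) auto
        moreover have "0 \<le> w'" using aw beta_gt_1 by (simp add: w'_def)
        ultimately show ?thesis using core[OF c] x' by (simp add: w'_def)
      next
        case 3
        then have "a = int m" unfolding a_def by linarith
        then have w': "w' = l + \<beta> * (r - w)" by (simp add: w'_def l_r algebra_simps)
        have "\<beta> * ((r - l) / \<beta> ^ Suc n) \<le> \<beta> * (r - w)"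
          using x 3 beta_gt_1 by (intro mult_left_mono) auto
        then have "l + (r - l) / \<beta> ^ n \<le> w'" using beta_gt_1 by (simp add: w')
        moreover have "w' < \<beta>"
          using \<open>a = int m\<close> 3 beta_gt_1 mult_pos_neg[of \<beta> "m - w"] by (simp add: w'_def)
        ultimately show ?thesis using C[OF c] x' by simp
      qed
      then show ?thesis using in_spectrum_if_remainder a unfolding x'_def by blast
    qed
    then show ?case by blast
  qed
  have "l < r" using lr m0 by simp
  show ?thesis
  proof (rule model_set_gaps[OF conj_diff conj_0_imp_0 finite_conj_box ex_small_positive_conj
        ex_small_negative_conj \<open>l < r\<close> inside])
    fix e :: real assume "0 < e"
    then obtain n where n: "(r - l) / \<beta> ^ n < e" using ex_small_power by blast
    obtain C where C: "\<And>x w. conj x w \<and> C \<le> x \<and> (- 1 < w \<or> l + (r - l) / \<beta> ^ n \<le> w)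
      \<and> (w < \<beta> \<or> w \<le> r - (r - l) / \<beta> ^ n) \<Longrightarrow> x \<in> spectrum m \<beta>"
      using fill[of n] by blast
    have "x \<in> spectrum m \<beta>" if "conj x w \<and> C \<le> x \<and> l + e \<le> w \<and> w \<le> r - e" for x w
      by (rule C[of x w]) (use that n in auto)
    then show "\<exists>C. \<forall>x w. conj x w \<and> C \<le> x \<and> l + e \<le> w \<and> w \<le> r - e \<longrightarrow> x \<in> spectrum m \<beta>"
      by blast
  qed
qed

end

section \<open>Quadratic Pisot units\<close>

lemma quadratic_pisot_unit_gaps:
  assumes "quadratic_pisot_unit \<beta>" "\<beta> - 1 < real m"
  shows "eventually_three_gaps (spectrum m \<beta>)"
proof -
  have b: "1 < \<beta>" using assms(1) by (simp add: quadratic_pisot_unit_def)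
  from assms(1) consider p :: int where "\<beta>\<^sup>2 - p * \<beta> - 1 = 0" | p :: int where "\<beta>\<^sup>2 - p * \<beta> + 1 = 0"
    by (auto simp: quadratic_pisot_unit_def larger_root_def)
  then show ?thesis
  proof cases
    case 1
    interpret quadratic_unit \<beta> "- 1 / \<beta>" p "- 1"
      by standard (use 1 b in \<open>auto simp: field_simps power2_eq_square\<close>)
    show ?thesis using spectrum_gaps_norm_neg_1 assms(2) by simp
  next
    case 2
    interpret quadratic_unit \<beta> "1 / \<beta>" p 1
      by standard (use 2 b in \<open>auto simp: field_simps power2_eq_square\<close>)
    show ?thesis using spectrum_gaps_norm_1 assms(2) by simp
  qed
qed

lemma power_in_spectrum:
  assumes "1 \<le> m"
  shows "\<beta> ^ n \<in> spectrum m \<beta>"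
proof (induction n)
  case 0
  show ?case using digit_in_spectrum[of 1 m \<beta>] assms by simp
next
  case (Suc n)
  show ?case using append_digit_in_spectrum[OF _ Suc, of 0] by simp
qed

theorem theorem1:
  fixes \<beta> :: real and m :: nat and y :: "nat \<Rightarrow> real"
  assumes "quadratic_pisot_unit \<beta>"
    and "real m > \<beta> - 1"
    and "y 0 = 0" and "strict_mono y" and "range y = spectrum m \<beta>"
  shows "\<exists>\<Delta>\<^sub>1 \<Delta>\<^sub>2 :: real. \<Delta>\<^sub>1 > 0 \<and> \<Delta>\<^sub>2 > 0 \<and>
           (\<forall>\<^sub>F k in cofinite. y (Suc k) - y k \<in> {\<Delta>\<^sub>1, \<Delta>\<^sub>2, \<Delta>\<^sub>1 + \<Delta>\<^sub>2})"
proof -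
  have b: "1 < \<beta>" using assms(1) by (simp add: quadratic_pisot_unit_def)
  then have m: "1 \<le> m" using assms(2) by linarith
  obtain D1 D2 C where D: "0 < D1" "0 < D2"
    and gaps: "\<forall>x\<in>range y. \<forall>x'\<in>range y. C \<le> x \<and> x < x' \<and>
      (\<forall>t\<in>range y. x < t \<longrightarrow> x' \<le> t) \<longrightarrow> x' - x \<in> {D1, D2, D1 + D2}"
    using quadratic_pisot_unit_gaps[OF assms(1,2)]
    unfolding assms(5)[symmetric] eventually_three_gaps_def
    by (elim exE conjE) (rule that)
  \<comment> \<open>The spectrum is unbounded, so the enumeration eventually exceeds the threshold \<open>C\<close>.\<close>
  obtain n where n: "C < \<beta> ^ n" using real_arch_pow[OF b] by blast
  have "\<beta> ^ n \<in> range y" using power_in_spectrum[OF m] assms(5) by simp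
  then obtain N where N: "\<beta> ^ n = y N" by blast
  have "y (Suc k) - y k \<in> {D1, D2, D1 + D2}" if "N \<le> k" for k
  proof (rule gaps[rule_format])
    have "y N \<le> y k" using that assms(4) by (simp add: strict_mono_less_eq)
    with n N have "C \<le> y k" by simp
    then show "C \<le> y k \<and> y k < y (Suc k) \<and> (\<forall>t\<in>range y. y k < t \<longrightarrow> y (Suc k) \<le> t)"
      using assms(4) by (auto simp: strict_mono_less strict_mono_less_eq)
  qed simp_all
  then have "\<forall>\<^sub>F k in cofinite. y (Suc k) - y k \<in> {D1, D2, D1 + D2}"
    unfolding cofinite_eq_sequentially eventually_sequentially by blast
  with D show ?thesis by blast
qed

end
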